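(* Let $\alpha\in(0,1)$ be a quadratic irrational of height $H$, and let $N\ge 0$ and $k\ge 0$ be integers. If $\theta_N\in R$ and $\theta_{N+1},\ldots,\theta_{N+k}\in L$, then $$k<N+2+\log_3 H.$$
   Context: Let $L=[0,1/3)$ and $R=[2/3,1)$. For an irrational $\alpha\in(0,1)$ and an integer $n\ge 0$, $\theta_n=\{3^n\alpha\}$ is the fractional part of $3^n\alpha$. The height of a quadratic irrational $\alpha$ is $H=\max\{|a|,|b|,|c|\}$, where $f(x)=ax^2+bx+c\in\mathbb{Z}[x]$ is the primitive irreducible minimal polynomial of $\alpha$. $\log_3$ is the logarithm to base $3$. *)

theory Defs
  imports Complex_Main "HOL-Computational_Algebra.Computational_Algebra"
begin

definition L :: "real set" where
  "L = {0..<1/3}"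

definition R :: "real set" where
  "R = {2/3..<1}"

definition \<theta> :: "real \<Rightarrow> nat \<Rightarrow> real" where
  "\<theta> \<alpha> n = frac (3 ^ n * \<alpha>)"

definition quadratic_irrational :: "real \<Rightarrow> bool" where
  "quadratic_irrational \<alpha> \<longleftrightarrow>
     \<alpha> \<notin> \<rat> \<and> (\<exists>p :: int poly. degree p = 2 \<and> poly (map_poly of_int p) \<alpha> = 0)"

(* Such a polynomial is unique only up to sign, so this is a relation;
   the height below does not depend on the sign. *)
definition is_primitive_minpoly :: "int poly \<Rightarrow> real \<Rightarrow> bool" where
  "is_primitive_minpoly f \<alpha> \<longleftrightarrow>
     content f = 1 \<and> irreducible f \<and> poly (map_poly of_int f) \<alpha> = 0"

definition has_height :: "real \<Rightarrow> int \<Rightarrow> bool" where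
  "has_height \<alpha> H \<longleftrightarrow>
     (\<exists>a b c :: int. a \<noteq> 0 \<and> is_primitive_minpoly [:c, b, a:] \<alpha> \<and> H = Max {\<bar>a\<bar>, \<bar>b\<bar>, \<bar>c\<bar>})"

end

theory Submission
  imports Defs
begin

text \<open>
  The bound is Liouville's inequality, applied to a single rational approximation of \<open>\<alpha>\<close>.
  As long as the orbit of \<open>\<theta>\<close> stays in \<open>L\<close>, each step multiplies it by exactly 3 without
  wrapping around, so a run of \<open>k\<close> visits to \<open>L\<close> forces \<open>\<theta> \<alpha> (N + 1) < 3 ^ -k\<close>.  With
  \<open>q = 3 ^ (N + 1)\<close> and \<open>p = \<lfloor>q \<alpha>\<rfloor>\<close> this says that \<open>p / q\<close> lies within \<open>3 ^ -k / q\<close> of \<open>\<alpha>\<close>.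
  On the other hand a rational in the unit interval with denominator \<open>q\<close> cannot be closer to a
  quadratic irrational of height \<open>H\<close> there than \<open>1 / (3 H q\<^sup>2)\<close> (lemma \<open>quadratic_liouville\<close>).
  Comparing the two gives \<open>3 ^ k < 3 H q = 3 ^ (N + 2) H\<close>, and the theorem is the logarithm of this inequality.
\<close>

lemma theta_Suc_if_in_L:
  assumes "\<theta> \<alpha> n \<in> L"
  shows "\<theta> \<alpha> (Suc n) = 3 * \<theta> \<alpha> n"
proof -
  have "3 ^ Suc n * \<alpha> - 3 * \<theta> \<alpha> n = of_int (3 * \<lfloor>3 ^ n * \<alpha>\<rfloor>)"
    by (simp add: \<theta>_def frac_def algebra_simps)
  then have "3 ^ Suc n * \<alpha> - 3 * \<theta> \<alpha> n \<in> \<int>"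
    by (metis Ints_of_int)
  moreover have "0 \<le> 3 * \<theta> \<alpha> n" "3 * \<theta> \<alpha> n < 1"
    using assms by (auto simp: L_def)
  ultimately show ?thesis
    by (simp only: \<theta>_def frac_unique_iff simp_thms)
qed

lemma theta_run_in_L:
  assumes "\<forall>i<k. \<theta> \<alpha> (m + i) \<in> L"
  shows "\<theta> \<alpha> (m + k) = 3 ^ k * \<theta> \<alpha> m"
  using assms by (induction k) (auto simp: theta_Suc_if_in_L)

text \<open>
  For \<open>f x = a * x\<^sup>2 + b * x + c\<close>, since \<open>f \<alpha> = 0\<close>, the value of \<open>f\<close> at \<open>r = p / q\<close> factors as
  \<open>(r - \<alpha>) * (a * (r + \<alpha>) + b)\<close>.  Neither factor vanishes, because \<open>a \<noteq> 0\<close> and \<open>\<alpha>\<close> is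
  irrational, so \<open>q\<^sup>2 f r\<close> is a nonzero integer and \<open>\<bar>f r\<bar> \<ge> 1 / q\<^sup>2\<close>; the second factor is at
  most \<open>3 H\<close> in absolute value for \<open>r\<close> and \<open>\<alpha>\<close> in the unit interval.
\<close>
lemma quadratic_liouville:
  fixes \<alpha> :: real and a b c p q H :: int
  assumes root: "a * \<alpha>\<^sup>2 + b * \<alpha> + c = 0"
    and "\<alpha> \<notin> \<rat>" "a \<noteq> 0" "q > 0"
    and H: "\<bar>a\<bar> \<le> H" "\<bar>b\<bar> \<le> H"
    and \<alpha>: "0 \<le> \<alpha>" "\<alpha> \<le> 1" and r: "0 \<le> p / q" "p / q \<le> 1"
  shows "1 \<le> 3 * H * q\<^sup>2 * \<bar>\<alpha> - p / q\<bar>"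
proof -
  define r :: real where "r = p / q"
  define s where "s = a * (r + \<alpha>) + b"
  have rat: "r \<in> \<rat>"
    by (simp add: r_def)
  have fr: "a * r\<^sup>2 + b * r + c = (r - \<alpha>) * s"
    using root unfolding s_def by algebra
  have "s \<noteq> 0"
  proof
    assume "s = 0"
    then have "\<alpha> = - b / a - r"
      using \<open>a \<noteq> 0\<close> by (simp add: s_def field_simps)
    also have "\<dots> \<in> \<rat>"
      using rat by simp
    finally show False
      using \<open>\<alpha> \<notin> \<rat>\<close> by simp
  qed
  then have nz: "(r - \<alpha>) * s \<noteq> 0"
    using rat \<open>\<alpha> \<notin> \<rat>\<close> by auto
  have int: "real_of_int (a * p\<^sup>2 + b * p * q + c * q\<^sup>2) = q\<^sup>2 * ((r - \<alpha>) * s)"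
    using \<open>q > 0\<close> unfolding fr[symmetric] unfolding r_def
    by (simp add: field_simps power2_eq_square)
  have "a * p\<^sup>2 + b * p * q + c * q\<^sup>2 \<noteq> 0"
    using int nz \<open>q > 0\<close> by (metis mult_eq_0_iff of_int_0 of_int_eq_0_iff less_irrefl power2_eq_square)
  then have "1 \<le> \<bar>real_of_int (a * p\<^sup>2 + b * p * q + c * q\<^sup>2)\<bar>"
    by linarith
  then have "1 \<le> q\<^sup>2 * \<bar>\<alpha> - r\<bar> * \<bar>s\<bar>"
    unfolding int by (simp add: abs_mult abs_minus_commute mult_ac)
  also have "\<bar>s\<bar> \<le> 3 * H"
  proof -
    have "\<bar>a * (r + \<alpha>)\<bar> \<le> real_of_int H * 2"
      unfolding abs_mult using H \<alpha> r by (intro mult_mono) (auto simp: r_def)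
    then show ?thesis
      using H unfolding s_def by linarith
  qed
  then have "q\<^sup>2 * \<bar>\<alpha> - r\<bar> * \<bar>s\<bar> \<le> q\<^sup>2 * \<bar>\<alpha> - r\<bar> * (3 * H)"
    by (intro mult_left_mono) auto
  finally show ?thesis
    by (simp add: r_def mult_ac)
qed

theorem proposition4p3:
  fixes \<alpha> :: real and H :: int and N k :: nat
  assumes "0 < \<alpha>" and "\<alpha> < 1"
    and "quadratic_irrational \<alpha>"
    and "has_height \<alpha> H"
    and "\<theta> \<alpha> N \<in> R"
    and "\<forall>i \<in> {1..k}. \<theta> \<alpha> (N + i) \<in> L"
  shows "real k < real N + 2 + log 3 (real_of_int H)"
proof -
  obtain a b c :: int where "a \<noteq> 0" "is_primitive_minpoly [:c, b, a:] \<alpha>"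
      and Hmax: "H = Max {\<bar>a\<bar>, \<bar>b\<bar>, \<bar>c\<bar>}"
    using \<open>has_height \<alpha> H\<close> by (auto simp: has_height_def)
  then have root: "a * \<alpha>\<^sup>2 + b * \<alpha> + c = 0"
    by (simp add: is_primitive_minpoly_def map_poly_pCons algebra_simps power2_eq_square)
  have irrat: "\<alpha> \<notin> \<rat>"
    using \<open>quadratic_irrational \<alpha>\<close> by (simp add: quadratic_irrational_def)
  have H: "\<bar>a\<bar> \<le> H" "\<bar>b\<bar> \<le> H" "H > 0"
    using \<open>a \<noteq> 0\<close> by (auto simp: Hmax)

  define q :: int where "q = 3 ^ (N + 1)"
  define p where "p = \<lfloor>q * \<alpha>\<rfloor>"
  define \<delta> where "\<delta> = \<theta> \<alpha> (N + 1)"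
  have q: "q > 0"
    by (simp add: q_def)
  have \<delta>: "\<delta> = q * \<alpha> - p"
    by (simp add: \<delta>_def \<theta>_def frac_def p_def q_def)
  have "\<delta> \<ge> 0"
    by (simp add: \<delta>_def \<theta>_def)
  have dist: "\<alpha> - p / q = \<delta> / q"
    using q by (simp add: \<delta> field_simps)
  have "p \<ge> 0"
    using \<open>0 < \<alpha>\<close> q by (simp add: p_def)
  have "p / q \<le> \<alpha>"
    using dist \<open>\<delta> \<ge> 0\<close> q by (smt (verit) divide_nonneg_pos of_int_0_less_iff)
  then have "p / q \<le> 1"
    using \<open>\<alpha> < 1\<close> by linarith

  have "\<theta> \<alpha> (N + 1 + i) \<in> L" if "i < k" for i
    using that bspec[OF assms(6), of "Suc i"] by simp
  then have "\<theta> \<alpha> (N + 1 + k) = 3 ^ k * \<delta>"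
    unfolding \<delta>_def by (intro theta_run_in_L) blast
  then have small: "3 ^ k * \<delta> < 1"
    by (metis \<theta>_def frac_lt_1)

  have "1 \<le> 3 * H * q\<^sup>2 * \<bar>\<alpha> - p / q\<bar>"
    using \<open>p \<ge> 0\<close> \<open>0 < \<alpha>\<close> \<open>\<alpha> < 1\<close> q
    by (intro quadratic_liouville[OF root irrat \<open>a \<noteq> 0\<close> q H(1,2) _ _ _ \<open>p / q \<le> 1\<close>]) auto
  also have "\<dots> = 3 * H * q * \<delta>"
    unfolding dist using \<open>\<delta> \<ge> 0\<close> q by (simp add: power2_eq_square)
  finally have "3 ^ k \<le> 3 ^ k * (3 * H * q * \<delta>)"
    by simp
  also have "\<dots> = (3 * H * q) * (3 ^ k * \<delta>)"
    by (simp add: mult_ac)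
  also have "\<dots> < 3 * H * q"
    using small H(3) q by (simp add: mult_less_cancel_left2 not_le)
  also have "\<dots> = 3 ^ (N + 2) * H"
    by (simp add: q_def)
  finally have "log 3 (3 ^ k) < log 3 (3 ^ (N + 2) * real_of_int H)"
    using H(3) by (subst log_less_cancel_iff) auto
  moreover have "log 3 (3 ^ (N + 2) * real_of_int H) = real (N + 2) + log 3 H"
    using H(3) by (subst log_mult) (auto simp only: log_pow_cancel, auto)
  ultimately show ?thesis
    by (simp add: log_nat_power)
qed

end
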